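(* Let $k$, $n$ and $s$ be positive integers and let $x_1,\ldots,x_n$ be independent variables. Then $$H_k^{(s)}(x_1,\ldots,x_n)=(-x_n)^{s+1}H_{k-s-1}^{(s)}(x_1,\ldots,x_n)+H_k^{(s)}(x_1,\ldots,x_{n-1})+x_nH_{k-1}^{(s)}(x_1,\ldots,x_{n-1})$$ and $$E_k^{(s)}(x_1,\ldots,x_n)=x_nE_{k-1}^{(s)}(x_1,\ldots,x_n)+E_k^{(s)}(x_1,\ldots,x_{n-1})-x_n^{s+1}E_{k-s-1}^{(s)}(x_1,\ldots,x_{n-1}).$$
   Context: For a positive integer $s$, $H_k^{(s)}$ and $E_k^{(s)}$ ($k\ge0$) are defined by the formal power series identities $$\sum_{k\ge0}H_k^{(s)}(x_1,\ldots,x_n)t^k=\prod_{i=1}^n\big(1-x_it+\cdots+(-x_it)^s\big)^{-1},\qquad \sum_{k\ge0}E_k^{(s)}(x_1,\ldots,x_n)t^k=\prod_{i=1}^n\big(1+x_it+\cdots+(x_it)^s\big),$$ with $H_j^{(s)}=E_j^{(s)}=0$ for $j<0$; for the empty list of variables (the case $n=1$, $n-1=0$) the empty product gives $H_0^{(s)}=E_0^{(s)}=1$ and $H_j^{(s)}=E_j^{(s)}=0$ for $j\ne0$. *)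

theory Defs
  imports
    "HOL-Library.Poly_Mapping"
    "HOL-Computational_Algebra.Formal_Power_Series"
begin

(* Polynomials in the independent variables x_0, x_1, x_2, ... : finitely supported maps
   from monomials (exponent vectors) to coefficients, multiplied by convolution. *)
type_synonym 'a mpoly = "(nat \<Rightarrow>\<^sub>0 nat) \<Rightarrow>\<^sub>0 'a"

definition Var :: "nat \<Rightarrow> 'a::comm_ring_1 mpoly" where
  "Var i = Poly_Mapping.single (Poly_Mapping.single i 1) 1"

definition H_factor :: "nat \<Rightarrow> 'r::comm_ring_1 \<Rightarrow> 'r fps" where
  "H_factor s a = (\<Sum>j=0..s. (- (fps_const a * fps_X)) ^ j)"

definition E_factor :: "nat \<Rightarrow> 'r::comm_ring_1 \<Rightarrow> 'r fps" where
  "E_factor s a = (\<Sum>j=0..s. (fps_const a * fps_X) ^ j)"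

(* The coefficients form a ring without a division operation, so the type class operation
   inverse is not available for these power series.  The library's fps_right_inverse f y is
   the inverse of f as soon as y is the inverse of the constant coefficient of f; here both
   are 1 (see H_factor_inverse below). *)
definition H_gen :: "nat \<Rightarrow> (nat \<Rightarrow> 'r::comm_ring_1) \<Rightarrow> nat \<Rightarrow> 'r fps" where
  "H_gen s x n = (\<Prod>i=1..n. fps_right_inverse (H_factor s (x i)) 1)"

definition E_gen :: "nat \<Rightarrow> (nat \<Rightarrow> 'r::comm_ring_1) \<Rightarrow> nat \<Rightarrow> 'r fps" where
  "E_gen s x n = (\<Prod>i=1..n. E_factor s (x i))"

(* H s x n k is H_k^(s)(x_1, ..., x_n), and E s x n k is E_k^(s)(x_1, ..., x_n). *)
definition H :: "nat \<Rightarrow> (nat \<Rightarrow> 'r::comm_ring_1) \<Rightarrow> nat \<Rightarrow> int \<Rightarrow> 'r" where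
  "H s x n k = (if k < 0 then 0 else fps_nth (H_gen s x n) (nat k))"

definition E :: "nat \<Rightarrow> (nat \<Rightarrow> 'r::comm_ring_1) \<Rightarrow> nat \<Rightarrow> int \<Rightarrow> 'r" where
  "E s x n k = (if k < 0 then 0 else fps_nth (E_gen s x n) (nat k))"

lemma H_factor_nth_0: "fps_nth (H_factor s a) 0 = 1"
proof -
  have "fps_nth (H_factor s a) 0 = (\<Sum>j=0..s. if j = 0 then 1 else 0)"
    unfolding H_factor_def fps_sum_nth
    by (intro sum.cong refl) (simp add: fps_power_zeroth power_0_left)
  then show ?thesis by simp
qed

lemma H_factor_inverse: "H_factor s a * fps_right_inverse (H_factor s a) 1 = 1"
  by (rule fps_right_inverse) (simp add: H_factor_nth_0)

end

theory Submission
  imports Defs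
begin

text \<open>
  Multiplying a factor by \<open>1 \<plusminus> x\<^sub>n t\<close> telescopes its geometric sum, so
  \<open>(1 - (- x\<^sub>n t)\<^bsup>s+1\<^esup>) H\<^sub>n(t) = (1 + x\<^sub>n t) H\<^sub>n\<^sub>-\<^sub>1(t)\<close> and
  \<open>(1 - x\<^sub>n t) E\<^sub>n(t) = (1 - (x\<^sub>n t)\<^bsup>s+1\<^esup>) E\<^sub>n\<^sub>-\<^sub>1(t)\<close>;
  the recurrences compare coefficients of \<open>t\<^sup>k\<close>.
\<close>

text \<open>The conditional has the same shape as in \<open>H_int_diff\<close> and
  \<open>E_int_diff\<close>, so extracted coefficients match integer-indexed values term by
  term.\<close>

lemma fps_nth_const_X_power_mult:
  fixes a :: "'r::comm_ring_1"
  shows "fps_nth ((fps_const a * fps_X) ^ m * G) k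
    = a ^ m * (if k < m then 0 else fps_nth G (k - m))"
proof -
  have "(fps_const a * fps_X) ^ m * G = fps_const (a ^ m) * (fps_X ^ m * G)"
    by (simp add: power_mult_distrib fps_const_power mult.assoc)
  then show ?thesis
    by (simp add: fps_X_power_mult_nth)
qed

lemma fps_nth_const_X_mult:
  fixes a :: "'r::comm_ring_1"
  shows "fps_nth (fps_const a * fps_X * G) k = a * (if k < 1 then 0 else fps_nth G (k - 1))"
  using fps_nth_const_X_power_mult[of a 1 G k] by simp

lemma H_factor_telescope:
  "(1 + fps_const a * fps_X) * H_factor s a = 1 - (fps_const (- a) * fps_X) ^ (s + 1)"
proof -
  have "(1 - - (fps_const a * fps_X)) * H_factor s a = 1 - (- (fps_const a * fps_X)) ^ Suc s"
    unfolding H_factor_def atLeast0AtMost by (rule sum_gp_basic)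
  \<comment> \<open>The sign moves into the constant, so that
    \<open>fps_nth_const_X_power_mult\<close> applies with \<open>- a\<close> for
    \<open>a\<close>.\<close>
  then show ?thesis
    by (simp only: diff_minus_eq_add Suc_eq_plus1 mult_minus_left flip: fps_const_neg)
qed

lemma E_factor_telescope:
  "(1 - fps_const a * fps_X) * E_factor s a = 1 - (fps_const a * fps_X) ^ (s + 1)"
  unfolding E_factor_def atLeast0AtMost Suc_eq_plus1[symmetric] by (rule sum_gp_basic)

lemma H_gen_recurrence:
  fixes x :: "nat \<Rightarrow> 'r::comm_ring_1"
  shows "H_gen s x (Suc m) = (fps_const (- x (Suc m)) * fps_X) ^ (s + 1) * H_gen s x (Suc m)
    + H_gen s x m + fps_const (x (Suc m)) * fps_X * H_gen s x m"
proof -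
  let ?a = "x (Suc m)"
  let ?y = "fps_const ?a * fps_X"
  have "H_gen s x (Suc m) = H_gen s x m * fps_right_inverse (H_factor s ?a) 1"
    by (simp add: H_gen_def)
  \<comment> \<open>The new factor of the product cancels against its inverse; this stands in for
    division.\<close>
  then have "H_factor s ?a * H_gen s x (Suc m) = H_gen s x m"
    by (metis H_factor_inverse mult.left_commute mult.right_neutral)
  then have "(1 + ?y) * H_gen s x m = (1 + ?y) * H_factor s ?a * H_gen s x (Suc m)"
    by (simp only: mult.assoc)
  then show ?thesis
    unfolding H_factor_telescope by (simp only: algebra_simps mult_1_left mult_1_right)
qed

text \<open>Here the new factor enters directly rather than inverted. Hence \<open>1 - ?y\<close>
  multiplies the longer product and the power \<open>s + 1\<close> falls on the shorter one, the
  reverse of \<open>H_gen_recurrence\<close>.\<close>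

lemma E_gen_recurrence:
  fixes x :: "nat \<Rightarrow> 'r::comm_ring_1"
  shows "E_gen s x (Suc m) = fps_const (x (Suc m)) * fps_X * E_gen s x (Suc m)
    + E_gen s x m - (fps_const (x (Suc m)) * fps_X) ^ (s + 1) * E_gen s x m"
proof -
  let ?a = "x (Suc m)"
  let ?y = "fps_const ?a * fps_X"
  have "E_gen s x (Suc m) = E_factor s ?a * E_gen s x m"
    by (simp add: E_gen_def mult.commute)
  then have "(1 - ?y) * E_gen s x (Suc m) = (1 - ?y) * E_factor s ?a * E_gen s x m"
    by (simp only: mult.assoc)
  then show ?thesis
    unfolding E_factor_telescope by (simp only: algebra_simps mult_1_left mult_1_right)
qed

text \<open>The guard matters: for \<open>k < m\<close> truncated subtraction would select the
  constant coefficient, whereas the integer index is negative and the value is 0.\<close>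

lemma H_int_diff: "H s x n (int k - int m) = (if k < m then 0 else fps_nth (H_gen s x n) (k - m))"
  by (auto simp: H_def nat_diff_distrib)

lemma E_int_diff: "E s x n (int k - int m) = (if k < m then 0 else fps_nth (E_gen s x n) (k - m))"
  by (auto simp: E_def nat_diff_distrib)

lemma H_recurrence:
  fixes x :: "nat \<Rightarrow> 'r::comm_ring_1"
  shows "H s x (Suc m) (int k) = (- x (Suc m)) ^ (s + 1) * H s x (Suc m) (int k - int s - 1)
    + H s x m (int k) + x (Suc m) * H s x m (int k - 1)"
  \<comment> \<open>The shifts \<open>s + 1\<close>, 1 and 0 are those of the recurrence. The number
    of variables stays open because shift 0 occurs with both \<open>Suc m\<close> and
    \<open>m\<close>.\<close>
  using arg_cong[OF H_gen_recurrence[of s x m], of "\<lambda>f. fps_nth f k"]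
    H_int_diff[of s x _ k "s + 1"] H_int_diff[of s x _ k 1] H_int_diff[of s x _ k 0]
  by (simp only: fps_add_nth fps_nth_const_X_power_mult fps_nth_const_X_mult of_nat_add of_nat_1
      of_nat_0 diff_diff_eq diff_zero not_less_zero if_False minus_nat.diff_0)

lemma E_recurrence:
  fixes x :: "nat \<Rightarrow> 'r::comm_ring_1"
  shows "E s x (Suc m) (int k) = x (Suc m) * E s x (Suc m) (int k - 1) + E s x m (int k)
    - x (Suc m) ^ (s + 1) * E s x m (int k - int s - 1)"
  using arg_cong[OF E_gen_recurrence[of s x m], of "\<lambda>f. fps_nth f k"]
    E_int_diff[of s x _ k "s + 1"] E_int_diff[of s x _ k 1] E_int_diff[of s x _ k 0]
  by (simp only: fps_add_nth fps_sub_nth fps_nth_const_X_power_mult fps_nth_const_X_mult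
      of_nat_add of_nat_1 of_nat_0 diff_diff_eq diff_zero not_less_zero if_False minus_nat.diff_0)

theorem theorem2p9:
  fixes k n s :: nat and x :: "nat \<Rightarrow> 'a::comm_ring_1 mpoly"
  defines "x \<equiv> Var"
  assumes "k > 0" and "n > 0" and "s > 0"
  shows "H s x n (int k)
           = (- x n) ^ (s + 1) * H s x n (int k - int s - 1)
             + H s x (n - 1) (int k) + x n * H s x (n - 1) (int k - 1)
       \<and> E s x n (int k)
           = x n * E s x n (int k - 1) + E s x (n - 1) (int k)
             - x n ^ (s + 1) * E s x (n - 1) (int k - int s - 1)"
proof -
  \<comment> \<open>With \<open>n = Suc m\<close>, the truncated \<open>n - 1\<close> is
    \<open>m\<close>, and the recurrences over an arbitrary commutative ring specialize to
    polynomials.\<close>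
  from \<open>n > 0\<close> obtain m where "n = Suc m"
    using gr0_conv_Suc by auto
  then show ?thesis
    using H_recurrence[of s x m k] E_recurrence[of s x m k] by simp
qed

end
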